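(* Let $f(z)=\sum_{k=0}^{\infty}c_kz^k$, $c_k\in\mathbb{C}$, be a formal power series, let $m\ge 0$, $n\ge 1$ be integers, put $c_k=0$ for $k<0$, and suppose that the sequence $c_{m-n+1},\ldots,c_{m+n}$ is non-zero (not all its terms are zero). Let $\mu_1$ be the first essential index and let $Q_1(z)$ be the first essential polynomial of this sequence. Then the set of all denominators $Q_{m,n}(z)$ of the $(m,n)$ Pade approximant of $f$ is $$\{Q_{m,n}(z)\}=\{q_1(z)Q_1(z)\},$$ where $q_1(z)$ runs over arbitrary non-zero polynomials of formal degree $m-\mu_1$. Thus, $Q_1(z)$ is the denominator of the $(m,n)$ Pade approximant with the minimal degree.
   Context: A polynomial $Q(z)\in\mathbb{C}[z]$ is called a denominator of the $(m,n)$ Pade approximant of $f$ if $Q\not\equiv 0$, $\deg Q\le n$, and there is a polynomial $P(z)$ with $\deg P\le m$ such that $f(z)Q(z)-P(z)=O(z^{m+n+1})$ as formal power series. The denominator of minimal degree exists and is unique up to a constant factor. Given a non-zero sequence $c_{m-n+1},\ldots,c_{m+n}$, define a linear functional $\sigma$ by $\sigma\{z^j\}=c_{-j}$, $-m-n\le j\le -m+n-1$. A polynomial has formal degree $d$ if its degree is at most $d$. For $m-n+1\le k\le m+n$ let $\mathcal{N}_k$ be the space of complex polynomials $Q(z)$ of formal degree $k-m+n-1$ (including zero) such that $\sigma\{z^{-i}Q(z)\}=0$ for $i=k,k+1,\ldots,m+n$. Put $\mathcal{N}_{m-n}=0$, and let $\mathcal{N}_{m+n+1}$ be the space of all polynomials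 of formal degree $2n$. Let $d_k=\dim\mathcal{N}_k$ and $\Delta_k=d_k-d_{k-1}$ for $m-n+1\le k\le m+n+1$. It is known that $0=\Delta_{m-n+1}\le\Delta_{m-n+2}\le\cdots\le\Delta_{m+n+1}=2$. The essential indices $\mu_1\le\mu_2$ are the integers defined by: $\Delta_k=0$ for $m-n+1\le k\le\mu_1$; $\Delta_k=1$ for $\mu_1+1\le k\le\mu_2$; $\Delta_k=2$ for $\mu_2+1\le k\le m+n+1$. It is known that $\mu_1\le m<\mu_2$. The subspace $\mathcal{N}_{\mu_1}+z\mathcal{N}_{\mu_1}$ has codimension $1$ in $\mathcal{N}_{\mu_1+1}$; a first essential polynomial $Q_1(z)$ is any polynomial spanning a one-dimensional complement of it in $\mathcal{N}_{\mu_1+1}$. *)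

theory Defs
  imports Complex_Main "HOL-Computational_Algebra.Computational_Algebra"
begin

text \<open>
  The denominators of the \<open>(m, n)\<close> Pade approximant of \<open>f\<close>; the last conjunct says
  \<open>f Q - P = O(z\<^bsup>m+n+1\<^esup>)\<close>.
\<close>

definition pade_denominator :: "complex fps \<Rightarrow> nat \<Rightarrow> nat \<Rightarrow> complex poly \<Rightarrow> bool" where
  "pade_denominator f m n Q \<longleftrightarrow>
     Q \<noteq> 0 \<and> degree Q \<le> n \<and>
     (\<exists>P. degree P \<le> m \<and>
        (\<forall>k < m + n + 1. fps_nth (f * fps_of_poly Q - fps_of_poly P) k = 0))"

definition coeff_seq :: "complex fps \<Rightarrow> int \<Rightarrow> complex" where
  "coeff_seq f k = (if k < 0 then 0 else fps_nth f (nat k))"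

text \<open>
  Polynomials and their products with powers of \<open>z\<^sup>-\<^sup>1\<close> are regarded as formal Laurent series.
  The functional \<open>\<sigma>\<close> is determined by \<open>\<sigma>{z\<^sup>j} = c\<^bsub>-j\<^esub>\<close> for \<open>-m-n \<le> j \<le> -m+n-1\<close>
  and linearity; coefficients outside this window are ignored, and do not occur below.
\<close>

definition sigma :: "(int \<Rightarrow> complex) \<Rightarrow> nat \<Rightarrow> nat \<Rightarrow> complex fls \<Rightarrow> complex" where
  "sigma c m n g = (\<Sum>j = - int m - int n .. - int m + int n - 1. c (- j) * fls_nth g j)"

lemma sigma_power:
  assumes "- int m - int n \<le> j" "j \<le> - int m + int n - 1"
  shows "sigma c m n (fls_X_intpow j) = c (- j)"
  using assms by (simp add: sigma_def if_distrib [of "\<lambda>x. _ * x"] sum.delta cong: if_cong)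

lemma sigma_add: "sigma c m n (g + h) = sigma c m n g + sigma c m n h"
  by (simp add: sigma_def algebra_simps sum.distrib)

lemma sigma_scale: "sigma c m n (fls_const a * g) = a * sigma c m n g"
  by (simp add: sigma_def sum_distrib_left mult.left_commute)

text \<open>
  The spaces \<open>\<N>\<^sub>k\<close>. The indices may be negative when \<open>m < n\<close>, hence \<open>k :: int\<close>. The outer
  branches are the conventions for \<open>k = m - n\<close> and \<open>k = m + n + 1\<close>; no other \<open>k\<close> outside
  \<open>m - n + 1 \<le> k \<le> m + n\<close> matters.
\<close>

definition kernel_space :: "(int \<Rightarrow> complex) \<Rightarrow> nat \<Rightarrow> nat \<Rightarrow> int \<Rightarrow> complex poly set" where
  "kernel_space c m n k =
     (if k \<le> int m - int n then {0}
      else if k \<ge> int m + int n + 1 then {Q. degree Q \<le> 2 * n}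
      else {Q. int (degree Q) \<le> k - int m + int n - 1 \<and>
               (\<forall>i \<in> {k .. int m + int n}.
                  sigma c m n (fls_X_intpow (- i) * fps_to_fls (fps_of_poly Q)) = 0)})"

text \<open>Complex polynomials as a vector space over the complex numbers.\<close>

interpretation cpoly: vector_space "smult :: complex \<Rightarrow> complex poly \<Rightarrow> complex poly"
  by unfold_locales (simp_all add: smult_add_left smult_add_right)

definition kernel_dim :: "(int \<Rightarrow> complex) \<Rightarrow> nat \<Rightarrow> nat \<Rightarrow> int \<Rightarrow> nat" where
  "kernel_dim c m n k = cpoly.dim (kernel_space c m n k)"

definition kernel_dim_diff :: "(int \<Rightarrow> complex) \<Rightarrow> nat \<Rightarrow> nat \<Rightarrow> int \<Rightarrow> int" where
  "kernel_dim_diff c m n k = int (kernel_dim c m n k) - int (kernel_dim c m n (k - 1))"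

definition essential_indices ::
    "(int \<Rightarrow> complex) \<Rightarrow> nat \<Rightarrow> nat \<Rightarrow> int \<Rightarrow> int \<Rightarrow> bool" where
  "essential_indices c m n \<mu>1 \<mu>2 \<longleftrightarrow>
     \<mu>1 \<le> \<mu>2 \<and>
     (\<forall>k \<in> {int m - int n + 1 .. int m + int n + 1}.
        (k \<le> \<mu>1 \<longrightarrow> kernel_dim_diff c m n k = 0) \<and>
        (\<mu>1 + 1 \<le> k \<and> k \<le> \<mu>2 \<longrightarrow> kernel_dim_diff c m n k = 1) \<and>
        (\<mu>2 + 1 \<le> k \<longrightarrow> kernel_dim_diff c m n k = 2))"

text \<open>
  \<open>Q\<close> spans a one-dimensional complement of \<open>W = \<N>\<^sub>\<mu> + z \<N>\<^sub>\<mu>\<close> in \<open>\<N>\<^bsub>\<mu>+1\<^esub>\<close>, with \<open>\<mu>\<close> to be the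
  first essential index; \<open>[:0, 1:]\<close> is the polynomial \<open>z\<close>.
\<close>

definition first_essential_poly ::
    "(int \<Rightarrow> complex) \<Rightarrow> nat \<Rightarrow> nat \<Rightarrow> int \<Rightarrow> complex poly \<Rightarrow> bool" where
  "first_essential_poly c m n \<mu> Q \<longleftrightarrow>
     (let W = {A + [:0, 1:] * B | A B. A \<in> kernel_space c m n \<mu> \<and> B \<in> kernel_space c m n \<mu>}
      in Q \<noteq> 0 \<and>
         cpoly.span {Q} \<inter> W = {0} \<and>
         {A + B | A B. A \<in> W \<and> B \<in> cpoly.span {Q}} = kernel_space c m n (\<mu> + 1))"

end

theory Submission
  imports Defs
begin

text \<open>
  A polynomial \<open>Q\<close> of degree at most \<open>k - m + n - 1\<close> lies in \<open>\<N>\<^sub>k\<close> exactly when \<open>f Q\<close> has no terms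
  of order \<open>k, \<dots>, m + n\<close> (\<open>kernel_space_iff\<close>). For \<open>k = m + 1\<close> these are the bound \<open>n\<close> on the
  degree and the gap which makes the low-order part of \<open>f Q\<close> an admissible numerator, so the
  denominators are the non-zero elements of \<open>\<N>\<^bsub>m+1\<^esub>\<close> (\<open>pade_denominator_iff_kernel_space\<close>).

  Multiplication by \<open>q\<close> mixes the coefficients of \<open>f Q\<close> over a window of length \<open>degree q\<close>, hence
  maps \<open>\<N>\<^sub>k\<close> into \<open>\<N>\<^bsub>k+d\<^esub>\<close> for \<open>degree q \<le> d\<close> (\<open>kernel_space_mult\<close>). Since \<open>Q\<^sub>1 \<in> \<N>\<^bsub>\<mu>\<^sub>1+1\<^esub>\<close>, all
  \<open>q\<^sub>1 Q\<^sub>1\<close> with \<open>degree q\<^sub>1 \<le> m - \<mu>\<^sub>1\<close> belong to \<open>\<N>\<^bsub>m+1\<^esub>\<close>, and they form a subspace of dimension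
  \<open>m - \<mu>\<^sub>1 + 1\<close>. That this is everything is a count of dimensions. Summing the increments \<open>\<Delta>\<^sub>k\<close> gives
  \<open>d\<^sub>k = max 0 (k - \<mu>\<^sub>1) + max 0 (k - \<mu>\<^sub>2)\<close> (\<open>kernel_dim_formula\<close>); its value \<open>2 n + 1\<close> at
  \<open>k = m + n + 1\<close> forces \<open>\<mu>\<^sub>1 \<le> m < \<mu>\<^sub>2\<close>, and then \<open>d\<^bsub>m+1\<^esub> = m + 1 - \<mu>\<^sub>1\<close>
  (\<open>kernel_dim_at_Suc\<close>).
\<close>

section \<open>Dimensions of spaces of polynomials\<close>

lemma cpoly_subspace_coeffs_zero: "cpoly.subspace {q. \<forall>j\<in>J. coeff q j = 0}"
  by (rule cpoly.subspaceI) auto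

text \<open>
  Each member of the family has a leading coefficient in a position where all its predecessors,
  and hence all their combinations, vanish.
\<close>

lemma independent_if_degree_strict_mono:
  fixes p :: "nat \<Rightarrow> complex poly"
  assumes nz: "\<And>i. p i \<noteq> 0" and mono: "strict_mono (\<lambda>i. degree (p i))"
  shows "cpoly.independent (p ` {..<N})"
proof (induction N)
  case 0
  show ?case by (simp add: cpoly.independent_empty)
next
  case (Suc N)
  let ?V = "{q. \<forall>j\<in>{degree (p N)..}. coeff q j = 0}"
  have "p ` {..<N} \<subseteq> ?V"
    using strict_monoD[OF mono] by (fastforce intro: coeff_eq_0)
  then have "cpoly.span (p ` {..<N}) \<subseteq> ?V"
    by (rule cpoly.span_minimal) (rule cpoly_subspace_coeffs_zero)
  moreover have "p N \<notin> ?V"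
    using nz[of N] by (auto intro!: bexI[of _ "degree (p N)"])
  ultimately have "p N \<notin> cpoly.span (p ` {..<N})" by blast
  then show ?case
    using Suc by (simp add: lessThan_Suc cpoly.independent_insert)
qed

context
  fixes Q :: "complex poly" and N :: nat
  assumes Q: "Q \<noteq> 0"
begin

lemma independent_shifts: "cpoly.independent ((\<lambda>i. monom 1 i * Q) ` {..<N})"
proof (rule independent_if_degree_strict_mono)
  show "monom 1 i * Q \<noteq> 0" for i using Q by simp
  show "strict_mono (\<lambda>i. degree (monom 1 i * Q))"
    using Q by (auto simp: strict_mono_def degree_mult_eq degree_monom_eq)
qed

lemma card_shifts: "card ((\<lambda>i. monom 1 i * Q) ` {..<N}) = N"
  using Q by (simp add: card_image inj_on_def monom_eq_iff')

end

lemma multiple_in_span_shifts: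
  assumes "degree q \<le> N"
  shows "q * Q \<in> cpoly.span ((\<lambda>i. monom 1 i * Q) ` {..<Suc N})"
proof -
  have "q * Q = (\<Sum>i\<le>N. smult (coeff q i) (monom 1 i * Q))"
    by (subst poly_as_sum_of_monoms'[OF assms, symmetric])
       (simp add: sum_distrib_right smult_monom flip: mult_smult_left)
  also have "\<dots> \<in> cpoly.span ((\<lambda>i. monom 1 i * Q) ` {..<Suc N})"
    by (intro cpoly.span_sum cpoly.span_scale cpoly.span_base) auto
  finally show ?thesis .
qed

lemma span_shifts:
  "cpoly.span ((\<lambda>i. monom 1 i * Q) ` {..<Suc N}) = {q * Q | q. degree q \<le> N}" (is "?L = ?R")
proof
  have "cpoly.subspace ?R"
  proof (rule cpoly.subspaceI)
    show "0 \<in> ?R" by (auto intro!: exI[of _ 0])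
    show "x + y \<in> ?R" if "x \<in> ?R" "y \<in> ?R" for x y
      using that by (auto simp: distrib_right[symmetric] intro: degree_add_le)
    show "smult a x \<in> ?R" if "x \<in> ?R" for a x
      using that by (auto simp flip: mult_smult_left intro: order_trans[OF degree_smult_le])
  qed
  moreover have "(\<lambda>i. monom 1 i * Q) ` {..<Suc N} \<subseteq> ?R"
    by (auto simp: degree_monom_eq intro!: exI[of _ "monom 1 _"])
  ultimately show "?L \<subseteq> ?R" by (rule cpoly.span_minimal[rotated])
  show "?R \<subseteq> ?L" using multiple_in_span_shifts by blast
qed

lemma degree_le_eq_span:
  "{q :: complex poly. degree q \<le> N} =
    cpoly.span ((\<lambda>i. monom 1 i * 1) ` {..<Suc N})"
  unfolding span_shifts by simp

lemma dim_degree_le: "cpoly.dim {q :: complex poly. degree q \<le> N} = Suc N"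
  unfolding degree_le_eq_span cpoly.dim_span
  using cpoly.dim_eq_card_independent[OF independent_shifts[OF one_neq_zero]]
    card_shifts[OF one_neq_zero] by metis

text \<open>
  The bound on the degrees is there because the dimension of an infinite-dimensional space is
  \<open>0\<close> by convention.
\<close>

lemma subset_span_if_dim_le_card:
  fixes V :: "complex poly set"
  assumes bound: "V \<subseteq> {q. degree q \<le> N}"
    and S: "S \<subseteq> V" "cpoly.independent S" and dim: "cpoly.dim V \<le> card S"
  shows "V \<subseteq> cpoly.span S"
proof (rule subsetI, rule ccontr)
  fix x assume x: "x \<in> V" "x \<notin> cpoly.span S"
  obtain B where B: "B \<subseteq> V" "cpoly.independent B" "V \<subseteq> cpoly.span B" "card B = cpoly.dim V"
    by (rule cpoly.basis_exists)
  have "B \<subseteq> cpoly.span ((\<lambda>i. monom 1 i * 1) ` {..<Suc N})"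
    using B(1) bound unfolding degree_le_eq_span by blast
  then have finB: "finite B"
    using cpoly.independent_span_bound[OF _ B(2)] by blast
  have "cpoly.independent (insert x S)"
    using x S by (simp add: cpoly.independent_insertI)
  moreover have "insert x S \<subseteq> cpoly.span B"
    using x S B(3) by blast
  ultimately have "finite (insert x S) \<and> card (insert x S) \<le> card B"
    by (rule cpoly.independent_span_bound[OF finB])
  moreover have "x \<notin> S" using x cpoly.span_base by blast
  ultimately show False using B(4) dim by auto
qed

section \<open>The kernel spaces in terms of coefficients of products\<close>

lemma coeff_seq_mult_poly:
  assumes "degree Q \<le> d"
  shows "coeff_seq (g * fps_of_poly Q) i = (\<Sum>l\<le>d. coeff Q l * coeff_seq g (i - int l))"
proof (cases "i < 0")
  case True
  then show ?thesis by (simp add: coeff_seq_def)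
next
  case False
  have "coeff_seq (g * fps_of_poly Q) i = (\<Sum>l\<le>nat i. coeff Q l * fps_nth g (nat i - l))"
    using False by (simp add: coeff_seq_def mult.commute[of g] fps_mult_nth atMost_atLeast0)
  also have "\<dots> = (\<Sum>l\<le>nat i. coeff Q l * coeff_seq g (i - int l))"
    using False by (intro sum.cong) (auto simp: coeff_seq_def nat_diff_distrib le_nat_iff)
  \<comment> \<open>The two ranges differ only in \<open>l > d\<close>, where \<open>Q\<close> has no coefficient, and in \<open>l > i\<close>, where
     the index \<open>i - l\<close> is negative.\<close>
  also have "\<dots> = (\<Sum>l\<le>max d (nat i). coeff Q l * coeff_seq g (i - int l))"
    by (rule sum.mono_neutral_left) (use False in \<open>auto simp: coeff_seq_def\<close>)
  also have "\<dots> = (\<Sum>l\<le>d. coeff Q l * coeff_seq g (i - int l))"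
    by (rule sum.mono_neutral_right) (use assms in \<open>auto intro!: coeff_eq_0\<close>)
  finally show ?thesis .
qed

text \<open>
  The two bounds keep all exponents of \<open>z\<^bsup>-i\<^esup> Q\<close> inside the window on which \<open>\<sigma>\<close> is supported.
\<close>

lemma sigma_shift_poly:
  assumes "i \<le> int m + int n" "int (degree Q) \<le> i - int m + int n - 1"
  shows "sigma (coeff_seq f) m n (fls_X_intpow (- i) * fps_to_fls (fps_of_poly Q))
           = coeff_seq (f * fps_of_poly Q) i"
proof -
  let ?h = "\<lambda>j. coeff_seq f (- j) * fls_nth (fps_to_fls (fps_of_poly Q)) (j + i)"
  have "sigma (coeff_seq f) m n (fls_X_intpow (- i) * fps_to_fls (fps_of_poly Q))
      = (\<Sum>j = - int m - int n .. - int m + int n - 1. ?h j)"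
    unfolding sigma_def fls_X_intpow_times_conv_shift fls_shift_nth by simp
  also have "\<dots> = (\<Sum>j = - i .. int (degree Q) - i. ?h j)"
    by (rule sum.mono_neutral_right) (use assms in \<open>auto intro!: coeff_eq_0\<close>)
  also have "\<dots> = (\<Sum>l\<le>degree Q. coeff Q l * coeff_seq f (i - int l))"
    by (rule sum.reindex_bij_witness[of _ "\<lambda>l. int l - i" "\<lambda>j. nat (j + i)"])
       (auto simp: mult.commute)
  also have "\<dots> = coeff_seq (f * fps_of_poly Q) i"
    by (rule coeff_seq_mult_poly[symmetric]) simp
  finally show ?thesis .
qed

lemma kernel_space_iff:
  assumes "int m - int n + 1 \<le> k" "k \<le> int m + int n"
  shows "Q \<in> kernel_space (coeff_seq f) m n k \<longleftrightarrow>
           int (degree Q) \<le> k - int m + int n - 1 \<and>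
           (\<forall>i\<in>{k..int m + int n}. coeff_seq (f * fps_of_poly Q) i = 0)"
proof -
  have "sigma (coeff_seq f) m n (fls_X_intpow (- i) * fps_to_fls (fps_of_poly Q))
      = coeff_seq (f * fps_of_poly Q) i"
    if "int (degree Q) \<le> k - int m + int n - 1" "i \<in> {k..int m + int n}" for i
    using that by (intro sigma_shift_poly) auto
  then show ?thesis
    using assms unfolding kernel_space_def by (auto simp del: fls_X_intpow_times_conv_shift)
qed

text \<open>
  The coefficient of order \<open>i \<ge> k + d\<close> in \<open>f q Q\<close> only involves those of orders \<open>i - d, \<dots>, i\<close> in
  \<open>f Q\<close>, all of which are at least \<open>k\<close>; so a gap starting at \<open>k\<close> loses at most its first \<open>d\<close> places.
\<close>

lemma kernel_space_mult:
  assumes k: "int m - int n + 1 \<le> k" "k + int d \<le> int m + int n"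
    and Q: "Q \<in> kernel_space (coeff_seq f) m n k" and q: "degree q \<le> d"
  shows "q * Q \<in> kernel_space (coeff_seq f) m n (k + int d)"
proof -
  have Q': "int (degree Q) \<le> k - int m + int n - 1"
      "\<And>i. k \<le> i \<Longrightarrow> i \<le> int m + int n \<Longrightarrow> coeff_seq (f * fps_of_poly Q) i = 0"
    using Q k by (auto simp: kernel_space_iff)
  have "coeff_seq (f * fps_of_poly (q * Q)) i = 0"
    if i: "i \<in> {k + int d..int m + int n}" for i
  proof -
    have "f * fps_of_poly (q * Q) = f * fps_of_poly Q * fps_of_poly q"
      by (simp add: fps_of_poly_mult mult_ac)
    then have "coeff_seq (f * fps_of_poly (q * Q)) i
        = (\<Sum>l\<le>d. coeff q l * coeff_seq (f * fps_of_poly Q) (i - int l))"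
      by (simp only: coeff_seq_mult_poly[OF q])
    also have "\<dots> = 0"
      using i by (intro sum.neutral) (auto intro!: Q'(2))
    finally show ?thesis .
  qed
  moreover have "int (degree (q * Q)) \<le> k + int d - int m + int n - 1"
    using degree_mult_le[of q Q] q Q'(1) by linarith
  ultimately show ?thesis using k by (simp add: kernel_space_iff)
qed

text \<open>
  The numerator is the truncation of \<open>f Q\<close> after the term of order \<open>m\<close>, so that a suitable one
  exists exactly when the terms of orders \<open>m + 1, \<dots>, m + n\<close> are zero.
\<close>

lemma pade_denominator_iff_kernel_space:
  assumes "n \<ge> 1"
  shows "pade_denominator f m n Q \<longleftrightarrow>
           Q \<noteq> 0 \<and> Q \<in> kernel_space (coeff_seq f) m n (int m + 1)"
proof -
  let ?g = "f * fps_of_poly Q"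
  have "(\<exists>P. degree P \<le> m \<and> (\<forall>k < m + n + 1. fps_nth (?g - fps_of_poly P) k = 0))
      \<longleftrightarrow> (\<forall>i\<in>{int m + 1..int m + int n}. coeff_seq ?g i = 0)" (is "?L \<longleftrightarrow> ?R")
  proof
    assume ?L
    then obtain P where P: "degree P \<le> m" "\<And>k. k < m + n + 1 \<Longrightarrow> fps_nth ?g k = coeff P k"
      by auto
    show ?R
    proof
      fix i assume i: "i \<in> {int m + 1..int m + int n}"
      then have "coeff_seq ?g i = coeff P (nat i)"
        using P(2)[of "nat i"] by (auto simp: coeff_seq_def)
      also have "\<dots> = 0" using P(1) i by (intro coeff_eq_0) auto
      finally show "coeff_seq ?g i = 0" .
    qed
  next
    assume R: ?R
    let ?P = "Poly (map (fps_nth ?g) [0..<Suc m])"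
    have coeff_P: "coeff ?P k = (if k \<le> m then fps_nth ?g k else 0)" for k
      by (auto simp: coeff_Poly_eq nth_default_def simp del: upt_Suc)
    have "fps_nth (?g - fps_of_poly ?P) k = 0" if "k < m + n + 1" for k
      using R[rule_format, of "int k"] that
      by (auto simp: coeff_P coeff_seq_def simp del: upt_Suc coeff_Poly_eq)
    moreover have "degree ?P \<le> m" by (rule degree_le) (simp add: coeff_P del: upt_Suc coeff_Poly_eq)
    ultimately show ?L by blast
  qed
  then show ?thesis
    using assms by (auto simp: pade_denominator_def kernel_space_iff)
qed

section \<open>Dimensions of the kernel spaces\<close>

lemma kernel_dim_start: "kernel_dim c m n (int m - int n) = 0"
  using cpoly.dim_span[of "{}"] cpoly.dim_eq_card_independent[OF cpoly.independent_empty]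
  by (simp add: kernel_dim_def kernel_space_def)

lemma kernel_dim_end: "kernel_dim c m n (int m + int n + 1) = 2 * n + 1"
  by (simp add: kernel_dim_def kernel_space_def dim_degree_le)

text \<open>A constant \<open>a\<close> in this space annihilates the whole sequence: \<open>a c\<^sub>i = 0\<close> for all \<open>i\<close>.\<close>

lemma kernel_dim_first:
  assumes "n \<ge> 1" "\<exists>k \<in> {int m - int n + 1 .. int m + int n}. coeff_seq f k \<noteq> 0"
  shows "kernel_dim (coeff_seq f) m n (int m - int n + 1) = 0"
proof -
  have "Q = 0" if "Q \<in> kernel_space (coeff_seq f) m n (int m - int n + 1)" for Q
  proof -
    have deg: "degree Q = 0"
      and van: "\<forall>i\<in>{int m - int n + 1..int m + int n}. coeff_seq (f * fps_of_poly Q) i = 0"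
      using that assms(1) by (auto simp: kernel_space_iff)
    have "coeff_seq (f * fps_of_poly Q) i = coeff Q 0 * coeff_seq f i" for i
      using deg by (simp add: coeff_seq_mult_poly[of Q 0])
    then have "coeff Q 0 = 0" using van assms(2) by auto
    then show "Q = 0" using deg by (metis leading_coeff_0_iff)
  qed
  then have "kernel_space (coeff_seq f) m n (int m - int n + 1) \<subseteq> {0}" by blast
  then show ?thesis
    using cpoly.dim_le_card[of _ "{}"] by (auto simp: kernel_dim_def)
qed

text \<open>
  The hypothesis on \<open>\<mu>1\<close> makes the right-hand side vanish at \<open>k = m - n\<close>, where the summation of
  the increments starts.
\<close>

lemma kernel_dim_formula:
  assumes ess: "essential_indices c m n \<mu>1 \<mu>2" and low: "int m - int n \<le> \<mu>1"
    and j: "j \<le> 2 * n + 1"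
  shows "int (kernel_dim c m n (int m - int n + int j)) =
           max 0 (int m - int n + int j - \<mu>1) + max 0 (int m - int n + int j - \<mu>2)"
  using j
proof (induction j)
  case 0
  show ?case using ess low by (simp add: kernel_dim_start essential_indices_def)
next
  case (Suc j)
  let ?k = "int m - int n + int (Suc j)"
  have "?k \<in> {int m - int n + 1..int m + int n + 1}" using Suc.prems by auto
  then have "kernel_dim_diff c m n ?k = (if ?k \<le> \<mu>1 then 0 else if ?k \<le> \<mu>2 then 1 else 2)"
    and "\<mu>1 \<le> \<mu>2"
    using ess unfolding essential_indices_def by auto
  moreover have "int (kernel_dim c m n ?k) =
      int (kernel_dim c m n (int m - int n + int j)) + kernel_dim_diff c m n ?k"
    by (simp add: kernel_dim_diff_def algebra_simps)
  ultimately show ?case using Suc by (auto simp: max_def)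
qed

text \<open>
  The value \<open>d\<^bsub>m+n+1\<^esub> = 2 n + 1\<close> excludes both \<open>\<mu>2 \<le> m\<close>, which would make it at least \<open>2 n + 2\<close>, and
  \<open>\<mu>1 > m\<close>, which would make it at most \<open>2 n\<close>.
\<close>

lemma kernel_dim_at_Suc:
  assumes "n \<ge> 1" "\<exists>k \<in> {int m - int n + 1 .. int m + int n}. coeff_seq f k \<noteq> 0"
    and ess: "essential_indices (coeff_seq f) m n \<mu>1 \<mu>2"
  shows "int m - int n + 1 \<le> \<mu>1" and "\<mu>1 \<le> int m"
    and "int (kernel_dim (coeff_seq f) m n (int m + 1)) = int m + 1 - \<mu>1"
proof -
  have le: "\<mu>1 \<le> \<mu>2" using ess by (simp add: essential_indices_def)
  show low: "int m - int n + 1 \<le> \<mu>1"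
  proof (rule ccontr)
    assume "\<not> ?thesis"
    then have "kernel_dim_diff (coeff_seq f) m n (int m - int n + 1) \<noteq> 0"
      using ess unfolding essential_indices_def
      by (cases "int m - int n + 1 \<le> \<mu>2") force+
    then show False
      using kernel_dim_first[OF assms(1,2)] kernel_dim_start by (simp add: kernel_dim_diff_def)
  qed
  then have "int m - int n \<le> \<mu>1" by simp
  note formula = kernel_dim_formula[OF ess this]
  have "int m - int n + int (2 * n + 1) = int m + int n + 1" by simp
  then have total: "2 * int n + 1
      = max 0 (int m + int n + 1 - \<mu>1) + max 0 (int m + int n + 1 - \<mu>2)"
    using formula[of "2 * n + 1"] by (simp only: kernel_dim_end)
  then show upper: "\<mu>1 \<le> int m" using le by (auto simp: max_def split: if_splits)
  have "int m < \<mu>2" using total le by (auto simp: max_def split: if_splits)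
  moreover have "int m - int n + int (n + 1) = int m + 1" by simp
  ultimately show "int (kernel_dim (coeff_seq f) m n (int m + 1)) = int m + 1 - \<mu>1"
    using formula[of "n + 1"] upper assms(1) by simp
qed

section \<open>The description of all denominators\<close>

lemma first_essential_poly_in_kernel_space:
  assumes "first_essential_poly c m n \<mu> Q"
  shows "Q \<noteq> 0" and "Q \<in> kernel_space c m n (\<mu> + 1)"
proof -
  obtain W where W: "cpoly.span {Q} \<inter> W = {0}"
      "{A + B | A B. A \<in> W \<and> B \<in> cpoly.span {Q}} = kernel_space c m n (\<mu> + 1)"
    and "Q \<noteq> 0"
    using assms unfolding first_essential_poly_def Let_def by blast
  then show "Q \<noteq> 0" by simp
  have "0 \<in> W" "Q \<in> cpoly.span {Q}" using W(1) by (auto intro: cpoly.span_base)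
  then have "0 + Q \<in> kernel_space c m n (\<mu> + 1)" unfolding W(2)[symmetric] by blast
  then show "Q \<in> kernel_space c m n (\<mu> + 1)" by simp
qed

theorem theorem3p2:
  fixes f :: "complex fps" and m n :: nat and \<mu>1 \<mu>2 :: int and Q1 :: "complex poly"
  assumes "n \<ge> 1"
    and "\<exists>k \<in> {int m - int n + 1 .. int m + int n}. coeff_seq f k \<noteq> 0"
    and "essential_indices (coeff_seq f) m n \<mu>1 \<mu>2"
    and "first_essential_poly (coeff_seq f) m n \<mu>1 Q1"
  shows "{Q. pade_denominator f m n Q} =
           {q1 * Q1 | q1. q1 \<noteq> 0 \<and> int (degree q1) \<le> int m - \<mu>1}
         \<and> pade_denominator f m n Q1 \<and>
         (\<forall>Q. pade_denominator f m n Q \<longrightarrow> degree Q1 \<le> degree Q) \<and>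
         (\<forall>Q. pade_denominator f m n Q \<and> degree Q = degree Q1 \<longrightarrow> (\<exists>a. a \<noteq> 0 \<and> Q = smult a Q1))"
proof -
  note Q1 = first_essential_poly_in_kernel_space[OF assms(4)]
  note idx = kernel_dim_at_Suc[OF assms(1-3)]
  define N where "N = nat (int m - \<mu>1)"
  have N: "int N = int m - \<mu>1" "\<mu>1 + 1 + int N = int m + 1" using idx(2) by (auto simp: N_def)
  let ?K = "kernel_space (coeff_seq f) m n (int m + 1)"
  let ?S = "(\<lambda>i. monom 1 i * Q1) ` {..<Suc N}"
  have multiples: "q * Q1 \<in> ?K" if "degree q \<le> N" for q
    using kernel_space_mult[OF _ _ Q1(2) that] idx(1) N(2) assms(1) by simp
  have "?K \<subseteq> cpoly.span ?S"
  proof (rule subset_span_if_dim_le_card)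
    show "?K \<subseteq> {q. degree q \<le> n}" using assms(1) by (auto simp: kernel_space_iff)
    show "?S \<subseteq> ?K" using multiples by (auto simp: degree_monom_eq)
    show "cpoly.independent ?S" using Q1(1) by (rule independent_shifts)
    show "cpoly.dim ?K \<le> card ?S"
      using idx(3) N unfolding card_shifts[OF Q1(1)] kernel_dim_def by simp
  qed
  then have K: "?K = {q * Q1 | q. degree q \<le> N}"
    using multiples unfolding span_shifts by blast
  have den: "pade_denominator f m n Q \<longleftrightarrow> (\<exists>q. Q = q * Q1 \<and> q \<noteq> 0 \<and> degree q \<le> N)" for Q
    unfolding pade_denominator_iff_kernel_space[OF assms(1)] K using Q1(1) by auto
  have "{Q. pade_denominator f m n Q} =
      {q1 * Q1 | q1. q1 \<noteq> 0 \<and> int (degree q1) \<le> int m - \<mu>1}"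
    unfolding den N(1)[symmetric] by auto
  moreover have "pade_denominator f m n Q1"
    unfolding den by (rule exI[of _ 1]) simp
  moreover have "degree Q1 \<le> degree Q" if "pade_denominator f m n Q" for Q
    using that Q1(1) unfolding den by (auto simp: degree_mult_eq)
  moreover have "\<exists>a. a \<noteq> 0 \<and> Q = smult a Q1"
    if den_Q: "pade_denominator f m n Q" and deg: "degree Q = degree Q1" for Q
  proof -
    obtain q where q: "Q = q * Q1" "q \<noteq> 0" using den_Q unfolding den by blast
    then have "degree q = 0" using deg Q1(1) by (simp add: degree_mult_eq)
    then obtain a where "q = [:a:]" by (rule degree_eq_zeroE)
    then show ?thesis using q by auto
  qed
  ultimately show ?thesis by blast
qed

end
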